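(* Let $p$ be a prime, $d\ge1$, and consider on $\mathbb{Q}_p^d$ the deformed metric $$\widetilde d(x,y)=\max_{1\le l\le d}\left(q_l|x_l-y_l|_p\right)$$ with parameters $q_1<q_2<\dots<q_d$, all $q_i\in(p^{-1},1]$. Then the group $O(\widetilde d)$ of linear isometries of $\mathbb{Q}_p^d$ for this metric is the subgroup of $O_d$ consisting of the matrices $A\in O_d$ which are upper triangular $\mathrm{mod}\ p$, i.e. whose matrix elements $A_{ab}$ with $a>b$ belong to $p\mathbb{Z}_p$.
   Context: $O_d$ is the group of linear transformations of $\mathbb{Q}_p^d$ which preserve the standard metric $|x-y|_p=\max_{1\le l\le d}|x_l-y_l|_p$; equivalently, the group of $d\times d$ matrices with entries in $\mathbb{Z}_p$ and $|\det|_p=1$. *)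

theory Defs
  imports
    Complex_Main
    "HOL-Computational_Algebra.Primes"
    "HOL-Algebra.Group"
    "Jordan_Normal_Form.Determinant"
    "Berlekamp_Zassenhaus.Finite_Field"
begin

section \<open>The field of \<open>p\<close>-adic numbers\<close>

text \<open>
  \<open>\<rat>\<^sub>p\<close> is constructed as the completion of the rationals with respect to the \<open>p\<close>-adic absolute
  value, i.e. as Cauchy sequences modulo null sequences. The prime is a type parameter:
  \<open>p = CARD('p)\<close> for a type \<open>'p\<close> of class \<open>prime_card\<close>, so that \<open>'p padic\<close> is an instance
  of class \<open>field\<close>.
\<close>

definition rat_padic_abs :: "nat \<Rightarrow> rat \<Rightarrow> real" where
  "rat_padic_abs p r = (if r = 0 then 0 else
     (case quotient_of r of (a, b) \<Rightarrow>
        real p powi (int (multiplicity (int p) b) - int (multiplicity (int p) a))))"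

definition padic_Cauchy :: "nat \<Rightarrow> (nat \<Rightarrow> rat) \<Rightarrow> bool" where
  "padic_Cauchy p X \<longleftrightarrow> (\<forall>e>0. \<exists>N. \<forall>m\<ge>N. \<forall>n\<ge>N. rat_padic_abs p (X m - X n) < e)"

definition padic_null :: "nat \<Rightarrow> (nat \<Rightarrow> rat) \<Rightarrow> bool" where
  "padic_null p X \<longleftrightarrow> (\<lambda>n. rat_padic_abs p (X n)) \<longlonglongrightarrow> 0"

definition padic_rel :: "nat \<Rightarrow> (nat \<Rightarrow> rat) \<Rightarrow> (nat \<Rightarrow> rat) \<Rightarrow> bool" where
  "padic_rel p X Y \<longleftrightarrow> padic_Cauchy p X \<and> padic_Cauchy p Y \<and> padic_null p (\<lambda>n. X n - Y n)"

subsection \<open>The \<open>p\<close>-adic absolute value on the rationals\<close>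

lemma rat_padic_abs_frac:
  assumes p: "prime p" and ab: "a \<noteq> 0" "b \<noteq> 0"
  shows "rat_padic_abs p (of_int a / of_int b) =
    real p powi (int (multiplicity (int p) b) - int (multiplicity (int p) a))"
proof -
  let ?r = "of_int a / of_int b :: rat"
  obtain c d where cd: "quotient_of ?r = (c, d)" by (cases "quotient_of ?r")
  have d: "d > 0" using quotient_of_denom_pos[OF cd] .
  have r: "?r = of_int c / of_int d" using quotient_of_div[OF cd] .
  have r0: "?r \<noteq> 0" using ab by simp
  have c: "c \<noteq> 0" using r r0 by auto
  have "(of_int (a * d) :: rat) = of_int (c * b)"
    using r ab d by (simp add: field_simps)
  hence eq: "a * d = c * b" by (simp only: of_int_eq_iff)
  have pe: "prime_elem (int p)" using p by auto
  have "multiplicity (int p) a + multiplicity (int p) d =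
        multiplicity (int p) c + multiplicity (int p) b"
    using prime_elem_multiplicity_mult_distrib[OF pe, of a d]
      prime_elem_multiplicity_mult_distrib[OF pe, of c b] eq ab c d by simp
  hence "int (multiplicity (int p) d) - int (multiplicity (int p) c) =
      int (multiplicity (int p) b) - int (multiplicity (int p) a)" by linarith
  thus ?thesis using r0 cd unfolding rat_padic_abs_def by simp
qed

lemma rat_frac_cases:
  obtains a b where "b \<noteq> 0" "(r::rat) = of_int a / of_int b"
proof -
  obtain c d where cd: "quotient_of r = (c, d)" by (cases "quotient_of r")
  show ?thesis using that[of d c] quotient_of_denom_pos[OF cd] quotient_of_div[OF cd] by simp
qed

lemma rat_padic_abs_0 [simp]: "rat_padic_abs p 0 = 0"
  by (simp add: rat_padic_abs_def)

lemma rat_padic_abs_pos: "prime p \<Longrightarrow> r \<noteq> 0 \<Longrightarrow> rat_padic_abs p r > 0"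
  by (auto simp: rat_padic_abs_def prime_gt_0_nat split: prod.splits)

lemma rat_padic_abs_nonneg: "prime p \<Longrightarrow> rat_padic_abs p r \<ge> 0"
  using rat_padic_abs_pos[of p r] by (cases "r = 0") auto

lemma rat_padic_abs_eq_0: "prime p \<Longrightarrow> rat_padic_abs p r = 0 \<longleftrightarrow> r = 0"
  using rat_padic_abs_pos[of p r] by (cases "r = 0") auto

lemma rat_padic_abs_1: "prime p \<Longrightarrow> rat_padic_abs p 1 = 1"
  using rat_padic_abs_frac[of p 1 1] by simp

lemma rat_padic_abs_mult:
  assumes p: "prime p"
  shows "rat_padic_abs p (r * s) = rat_padic_abs p r * rat_padic_abs p s"
proof (cases "r = 0 \<or> s = 0")
  case False
  obtain a b where ab: "b \<noteq> 0" "r = of_int a / of_int b" by (rule rat_frac_cases)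
  obtain c d where cd: "d \<noteq> 0" "s = of_int c / of_int d" by (rule rat_frac_cases)
  have a: "a \<noteq> 0" "c \<noteq> 0" using False ab cd by auto
  have rs: "r * s = of_int (a * c) / of_int (b * d)" using ab cd by simp
  have pe: "prime_elem (int p)" using p by auto
  have p0: "real p \<noteq> 0" using prime_gt_0_nat[OF p] by simp
  have "rat_padic_abs p (r * s) =
    real p powi (int (multiplicity (int p) (b * d)) - int (multiplicity (int p) (a * c)))"
    unfolding rs by (rule rat_padic_abs_frac) (use p ab cd a in auto)
  also have "int (multiplicity (int p) (b * d)) - int (multiplicity (int p) (a * c)) =
     (int (multiplicity (int p) b) - int (multiplicity (int p) a)) +
     (int (multiplicity (int p) d) - int (multiplicity (int p) c))"
    using ab cd a by (simp add: prime_elem_multiplicity_mult_distrib[OF pe])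
  also have "real p powi \<dots> = rat_padic_abs p r * rat_padic_abs p s"
    unfolding ab(2) cd(2) using p0 p ab cd a
    by (simp add: rat_padic_abs_frac power_int_add)
  finally show ?thesis .
qed auto

lemma rat_padic_abs_add:
  assumes p: "prime p"
  shows "rat_padic_abs p (r + s) \<le> max (rat_padic_abs p r) (rat_padic_abs p s)"
proof (cases "r = 0 \<or> s = 0 \<or> r + s = 0")
  case True
  thus ?thesis using rat_padic_abs_nonneg[OF p, of r] rat_padic_abs_nonneg[OF p, of s] by auto
next
  case False
  obtain a' b where ab': "b \<noteq> 0" "r = of_int a' / of_int b" by (rule rat_frac_cases)
  obtain c' d where cd': "d \<noteq> 0" "s = of_int c' / of_int d" by (rule rat_frac_cases)
  define a c e where "a = a' * d" and "c = c' * b" and "e = b * d"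
  have e: "e \<noteq> 0" using ab' cd' by (simp add: e_def)
  have r: "r = of_int a / of_int e" and s: "s = of_int c / of_int e"
    using ab' cd' by (auto simp: a_def c_def e_def)
  have rs: "r + s = of_int (a + c) / of_int e"
    unfolding r s by (simp add: add_divide_distrib)
  have ne: "a \<noteq> 0" "c \<noteq> 0" "a + c \<noteq> 0" using False r s rs by auto
  have unit: "\<not> is_unit (int p)" using prime_gt_1_nat[OF p] by simp
  let ?m = "multiplicity (int p)"
  have "int p ^ min (?m a) (?m c) dvd a + c"
    by (intro dvd_add) (meson multiplicity_dvd' min.cobounded1 min.cobounded2)+
  hence "?m (a + c) \<ge> min (?m a) (?m c)"
    using unit ne by (intro multiplicity_geI) auto
  hence "int (?m e) - int (?m (a + c)) \<le> max (int (?m e) - int (?m a)) (int (?m e) - int (?m c))"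
    by linarith
  hence "real p powi (int (?m e) - int (?m (a + c)))
    \<le> real p powi (max (int (?m e) - int (?m a)) (int (?m e) - int (?m c)))"
    using prime_gt_1_nat[OF p] by (intro power_int_increasing) auto
  also have "\<dots> \<le> max (real p powi (int (?m e) - int (?m a))) (real p powi (int (?m e) - int (?m c)))"
    by (auto simp: max_def)
  finally show ?thesis
    unfolding rs unfolding r s rat_padic_abs_frac[OF p ne(1) e] rat_padic_abs_frac[OF p ne(2) e]
      rat_padic_abs_frac[OF p ne(3) e] .
qed

lemma rat_padic_abs_minus: "prime p \<Longrightarrow> rat_padic_abs p (- r) = rat_padic_abs p r"
proof -
  assume p: "prime p"
  have "rat_padic_abs p (-1) * rat_padic_abs p (-1) = 1"
    using rat_padic_abs_mult[OF p, of "-1" "-1"] rat_padic_abs_1[OF p] by simp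
  hence "rat_padic_abs p (-1) = 1"
    using rat_padic_abs_nonneg[OF p, of "-1"] by (simp add: square_eq_1_iff)
  thus ?thesis using rat_padic_abs_mult[OF p, of "-1" r] by simp
qed

lemma rat_padic_abs_minus_commute:
  "prime p \<Longrightarrow> rat_padic_abs p (r - s) = rat_padic_abs p (s - r)"
  using rat_padic_abs_minus[of p "r - s"] by simp

lemma rat_padic_abs_triangle:
  assumes p: "prime p"
  shows "rat_padic_abs p (r + s) \<le> rat_padic_abs p r + rat_padic_abs p s"
  using rat_padic_abs_add[OF p, of r s] rat_padic_abs_nonneg[OF p, of r]
    rat_padic_abs_nonneg[OF p, of s] by linarith

lemma rat_padic_abs_diff:
  assumes p: "prime p"
  shows "\<bar>rat_padic_abs p r - rat_padic_abs p s\<bar> \<le> rat_padic_abs p (r - s)"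
  using rat_padic_abs_triangle[OF p, of "r - s" s] rat_padic_abs_triangle[OF p, of "s - r" r]
    rat_padic_abs_minus_commute[OF p, of r s] by simp

lemma rat_padic_abs_inverse:
  assumes p: "prime p"
  shows "rat_padic_abs p (inverse r) = inverse (rat_padic_abs p r)"
proof (cases "r = 0")
  case False
  have "rat_padic_abs p r * rat_padic_abs p (inverse r) = 1"
    using rat_padic_abs_mult[OF p, of r "inverse r"] rat_padic_abs_1[OF p] False by simp
  thus ?thesis by (metis inverse_unique)
qed simp

subsection \<open>Cauchy sequences and null sequences\<close>

lemma padic_null_iff:
  assumes p: "prime p"
  shows "padic_null p X \<longleftrightarrow> (\<forall>e>0. \<exists>N. \<forall>n\<ge>N. rat_padic_abs p (X n) < e)"
  unfolding padic_null_def LIMSEQ_iff using rat_padic_abs_nonneg[OF p] by simp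

lemma padic_null_add:
  assumes p: "prime p" and X: "padic_null p X" and Y: "padic_null p Y"
  shows "padic_null p (\<lambda>n. X n + Y n)"
  unfolding padic_null_def
proof (rule tendsto_sandwich[OF _ _ tendsto_const])
  show "(\<lambda>n. rat_padic_abs p (X n) + rat_padic_abs p (Y n)) \<longlonglongrightarrow> 0"
    using tendsto_add[OF X[unfolded padic_null_def] Y[unfolded padic_null_def]] by simp
qed (auto simp: p rat_padic_abs_nonneg rat_padic_abs_triangle)

lemma padic_null_minus: "prime p \<Longrightarrow> padic_null p X \<Longrightarrow> padic_null p (\<lambda>n. - X n)"
  by (simp add: padic_null_def rat_padic_abs_minus)

lemma padic_null_0 [simp]: "padic_null p (\<lambda>n. 0)"
  by (simp add: padic_null_def)

lemma padic_null_bounded_mult: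
  assumes p: "prime p" and X: "padic_null p X" and Y: "\<And>n. rat_padic_abs p (Y n) \<le> B"
  shows "padic_null p (\<lambda>n. X n * Y n)"
  unfolding padic_null_def
proof (rule tendsto_sandwich[OF _ _ tendsto_const])
  show "(\<lambda>n. rat_padic_abs p (X n) * B) \<longlonglongrightarrow> 0"
    using tendsto_mult_right[OF X[unfolded padic_null_def], of B] by simp
qed (auto simp: p rat_padic_abs_nonneg rat_padic_abs_mult intro!: always_eventually mult_left_mono Y)

lemma padic_null_imp_Cauchy:
  assumes p: "prime p" and X: "padic_null p X"
  shows "padic_Cauchy p X"
  unfolding padic_Cauchy_def
proof (intro allI impI)
  fix e :: real assume "e > 0"
  then obtain N where N: "\<forall>n\<ge>N. rat_padic_abs p (X n) < e"
    using X padic_null_iff[OF p] by blast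
  show "\<exists>N. \<forall>m\<ge>N. \<forall>n\<ge>N. rat_padic_abs p (X m - X n) < e"
  proof (intro exI allI impI)
    fix m n assume "m \<ge> N" "n \<ge> N"
    thus "rat_padic_abs p (X m - X n) < e"
      using rat_padic_abs_add[OF p, of "X m" "- X n"] N rat_padic_abs_minus[OF p, of "X n"]
      by (metis add_uminus_conv_diff max_less_iff_conj order_le_less_trans)
  qed
qed

lemma padic_Cauchy_const [simp]: "padic_Cauchy p (\<lambda>n. c)"
  by (simp add: padic_Cauchy_def)

lemma padic_Cauchy_add:
  assumes p: "prime p" and X: "padic_Cauchy p X" and Y: "padic_Cauchy p Y"
  shows "padic_Cauchy p (\<lambda>n. X n + Y n)"
  unfolding padic_Cauchy_def
proof (intro allI impI)
  fix e :: real assume e: "e > 0"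
  obtain N where N: "\<forall>m\<ge>N. \<forall>n\<ge>N. rat_padic_abs p (X m - X n) < e"
    using X e unfolding padic_Cauchy_def by blast
  obtain M where M: "\<forall>m\<ge>M. \<forall>n\<ge>M. rat_padic_abs p (Y m - Y n) < e"
    using Y e unfolding padic_Cauchy_def by blast
  show "\<exists>N. \<forall>m\<ge>N. \<forall>n\<ge>N. rat_padic_abs p (X m + Y m - (X n + Y n)) < e"
  proof (intro exI[of _ "max M N"] allI impI)
    fix m n assume mn: "m \<ge> max M N" "n \<ge> max M N"
    have "rat_padic_abs p (X m - X n) < e" "rat_padic_abs p (Y m - Y n) < e"
      using mn N M by auto
    thus "rat_padic_abs p (X m + Y m - (X n + Y n)) < e"
      using rat_padic_abs_add[OF p, of "X m - X n" "Y m - Y n"] by (simp add: algebra_simps)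
  qed
qed

lemma padic_Cauchy_minus: 
  assumes p: "prime p" and X: "padic_Cauchy p X" 
  shows "padic_Cauchy p (\<lambda>n. - X n)"
  using X rat_padic_abs_minus_commute[OF p] unfolding padic_Cauchy_def by simp

lemma padic_Cauchy_bounded:
  assumes p: "prime p" and X: "padic_Cauchy p X"
  obtains B where "B > 0" "\<And>n. rat_padic_abs p (X n) \<le> B"
proof -
  obtain N where N: "\<forall>m\<ge>N. \<forall>n\<ge>N. rat_padic_abs p (X m - X n) < 1"
    using X[unfolded padic_Cauchy_def, rule_format, of 1] by auto
  define B where "B = 1 + (\<Sum>i\<le>N. rat_padic_abs p (X i))"
  have le: "rat_padic_abs p (X i) \<le> B - 1" if "i \<le> N" for i
    unfolding B_def using that member_le_sum[of i "{..N}" "\<lambda>i. rat_padic_abs p (X i)"]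
    by (simp add: rat_padic_abs_nonneg[OF p])
  have "rat_padic_abs p (X n) \<le> B" for n
  proof (cases "n \<le> N")
    case True
    thus ?thesis using le[of n] by simp
  next
    case False
    hence "rat_padic_abs p (X n - X N) < 1" using N by simp
    thus ?thesis using le[of N] rat_padic_abs_triangle[OF p, of "X n - X N" "X N"] by simp
  qed
  moreover have "B > 0" unfolding B_def
    by (smt (verit) sum_nonneg rat_padic_abs_nonneg[OF p])
  ultimately show ?thesis using that by blast
qed

lemma padic_Cauchy_mult:
  assumes p: "prime p" and X: "padic_Cauchy p X" and Y: "padic_Cauchy p Y"
  shows "padic_Cauchy p (\<lambda>n. X n * Y n)"
  unfolding padic_Cauchy_def
proof (intro allI impI)
  fix e :: real assume e: "e > 0"
  obtain B where B: "B > 0" "\<And>n. rat_padic_abs p (X n) \<le> B" by (rule padic_Cauchy_bounded[OF p X]) blast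
  obtain C where C: "C > 0" "\<And>n. rat_padic_abs p (Y n) \<le> C" by (rule padic_Cauchy_bounded[OF p Y]) blast
  obtain N where N: "\<forall>m\<ge>N. \<forall>n\<ge>N. rat_padic_abs p (X m - X n) < e / C"
    using X e C unfolding padic_Cauchy_def by (meson divide_pos_pos)
  obtain M where M: "\<forall>m\<ge>M. \<forall>n\<ge>M. rat_padic_abs p (Y m - Y n) < e / B"
    using Y e B unfolding padic_Cauchy_def by (meson divide_pos_pos)
  show "\<exists>N. \<forall>m\<ge>N. \<forall>n\<ge>N. rat_padic_abs p (X m * Y m - X n * Y n) < e"
  proof (intro exI[of _ "max M N"] allI impI)
    fix m n assume mn: "m \<ge> max M N" "n \<ge> max M N"
    have 1: "rat_padic_abs p (X m - X n) < e / C" and 2: "rat_padic_abs p (Y m - Y n) < e / B"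
      using mn N M by auto
    have "rat_padic_abs p ((X m - X n) * Y m) \<le> rat_padic_abs p (X m - X n) * C"
      unfolding rat_padic_abs_mult[OF p] by (intro mult_left_mono C rat_padic_abs_nonneg p)
    also have "\<dots> < e" using 1 C by (simp add: field_simps)
    finally have 3: "rat_padic_abs p ((X m - X n) * Y m) < e" .
    have "rat_padic_abs p (X n * (Y m - Y n)) \<le> B * rat_padic_abs p (Y m - Y n)"
      unfolding rat_padic_abs_mult[OF p] by (intro mult_right_mono B rat_padic_abs_nonneg p)
    also have "\<dots> < e" using 2 B by (simp add: field_simps)
    finally have 4: "rat_padic_abs p (X n * (Y m - Y n)) < e" .
    have "X m * Y m - X n * Y n = (X m - X n) * Y m + X n * (Y m - Y n)"
      by (simp add: algebra_simps)
    thus "rat_padic_abs p (X m * Y m - X n * Y n) < e"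
      using rat_padic_abs_add[OF p, of "(X m - X n) * Y m" "X n * (Y m - Y n)"] 3 4 by simp
  qed
qed

lemma padic_Cauchy_not_null:
  assumes p: "prime p" and X: "padic_Cauchy p X" and nn: "\<not> padic_null p X"
  obtains e N where "e > 0" "\<And>n. n \<ge> N \<Longrightarrow> rat_padic_abs p (X n) \<ge> e"
proof -
  obtain e where e: "e > 0" "\<And>N. \<exists>n\<ge>N. rat_padic_abs p (X n) \<ge> e"
    using nn unfolding padic_null_iff[OF p] by (meson not_le)
  obtain N where N: "\<forall>m\<ge>N. \<forall>n\<ge>N. rat_padic_abs p (X m - X n) < e"
    using X e unfolding padic_Cauchy_def by blast
  obtain n where n: "n \<ge> N" "rat_padic_abs p (X n) \<ge> e" using e by blast
  have "rat_padic_abs p (X m) \<ge> e" if "m \<ge> N" for m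
  proof (rule ccontr)
    assume "\<not> ?thesis"
    thus False using N that n rat_padic_abs_add[OF p, of "X n - X m" "X m"]
      by (smt (verit) diff_add_cancel)
  qed
  thus ?thesis using that e by blast
qed

lemma padic_Cauchy_inverse:
  assumes p: "prime p" and X: "padic_Cauchy p X" and nn: "\<not> padic_null p X"
  shows "padic_Cauchy p (\<lambda>n. inverse (X n))"
proof -
  obtain c N where c: "c > 0" "\<And>n. n \<ge> N \<Longrightarrow> rat_padic_abs p (X n) \<ge> c"
    by (rule padic_Cauchy_not_null[OF p X nn]) blast
  show ?thesis unfolding padic_Cauchy_def
  proof (intro allI impI)
    fix e :: real assume e: "e > 0"
    then obtain M where M: "\<forall>m\<ge>M. \<forall>n\<ge>M. rat_padic_abs p (X m - X n) < e * (c * c)"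
      using X c unfolding padic_Cauchy_def by (meson mult_pos_pos)
    show "\<exists>N. \<forall>m\<ge>N. \<forall>n\<ge>N. rat_padic_abs p (inverse (X m) - inverse (X n)) < e"
    proof (intro exI[of _ "max M N"] allI impI)
      fix m n assume mn: "m \<ge> max M N" "n \<ge> max M N"
      have m: "rat_padic_abs p (X m) \<ge> c" and n: "rat_padic_abs p (X n) \<ge> c"
        using c mn by auto
      have ne: "X m \<noteq> 0" "X n \<noteq> 0" using m n c by auto
      have "inverse (X m) - inverse (X n) = (X n - X m) * inverse (X m * X n)"
        using ne by (simp add: field_simps)
      hence "rat_padic_abs p (inverse (X m) - inverse (X n)) =
        rat_padic_abs p (X n - X m) / (rat_padic_abs p (X m) * rat_padic_abs p (X n))"
        by (simp add: rat_padic_abs_mult[OF p] rat_padic_abs_inverse[OF p] divide_inverse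
              del: inverse_mult_distrib)
      also have "\<dots> \<le> rat_padic_abs p (X n - X m) / (c * c)"
        using m n c by (intro divide_left_mono mult_mono mult_pos_pos rat_padic_abs_nonneg p) auto
      also have "\<dots> < e" using M mn c by (simp add: field_simps)
      finally show "rat_padic_abs p (inverse (X m) - inverse (X n)) < e" .
    qed
  qed
qed

lemma padic_rel_null:
  assumes p: "prime p" and XY: "padic_rel p X Y" and X: "padic_null p X"
  shows "padic_null p Y"
  using padic_null_add[OF p X padic_null_minus[OF p, of "\<lambda>n. X n - Y n"]] XY
  by (simp add: padic_rel_def)

lemma padic_part_equivp: 
  assumes p: "prime p" 
  shows "part_equivp (padic_rel p)"
proof (rule part_equivpI)
  show "\<exists>x. padic_rel p x x" by (intro exI[of _ "\<lambda>_. 0"]) (simp add: padic_rel_def)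
  show "symp (padic_rel p)"
    using padic_null_minus[OF p] by (fastforce simp: symp_def padic_rel_def)
  show "transp (padic_rel p)"
    unfolding transp_def padic_rel_def using padic_null_add[OF p] by fastforce
qed

subsection \<open>The type of \<open>p\<close>-adic numbers\<close>

typedef (overloaded) 'p padic =
  "{c. \<exists>X. padic_Cauchy CARD('p::prime_card) X \<and> c = {Y. padic_rel CARD('p) X Y}}"
  by (blast intro: padic_Cauchy_const)

text \<open>The limit of a Cauchy sequence of rationals, and a chosen sequence with a given limit.\<close>

definition padic_of_seq :: "(nat \<Rightarrow> rat) \<Rightarrow> 'p::prime_card padic" where
  "padic_of_seq X = Abs_padic {Y. padic_rel CARD('p) X Y}"

definition seq_of_padic :: "'p::prime_card padic \<Rightarrow> nat \<Rightarrow> rat" where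
  "seq_of_padic x = (SOME X. X \<in> Rep_padic x)"

lemma padic_rel_refl: "padic_Cauchy p X \<Longrightarrow> padic_rel p X X"
  by (simp add: padic_rel_def)

lemma seq_of_padic_class:
  fixes x :: "'p::prime_card padic"
  shows "padic_Cauchy CARD('p) (seq_of_padic x)"
    and "Rep_padic x = {Y. padic_rel CARD('p) (seq_of_padic x) Y}"
proof -
  obtain X where X: "padic_Cauchy CARD('p) X" "Rep_padic x = {Y. padic_rel CARD('p) X Y}"
    using Rep_padic[of x] by blast
  have "X \<in> Rep_padic x" using X padic_rel_refl by auto
  hence "seq_of_padic x \<in> Rep_padic x" unfolding seq_of_padic_def by (metis someI)
  hence r: "padic_rel CARD('p) X (seq_of_padic x)" using X by simp
  show "padic_Cauchy CARD('p) (seq_of_padic x)" using r by (simp add: padic_rel_def)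
  show "Rep_padic x = {Y. padic_rel CARD('p) (seq_of_padic x) Y}"
    using X(2) r padic_part_equivp[OF prime_card[where 'a='p]]
    by (auto dest: part_equivp_symp part_equivp_transp)
qed

lemmas Cauchy_seq_of_padic = seq_of_padic_class(1)

lemma padic_of_seq_of_padic [simp]: "padic_of_seq (seq_of_padic x) = x"
  unfolding padic_of_seq_def seq_of_padic_class(2)[symmetric] by (rule Rep_padic_inverse)

lemma padic_of_seq_eq_iff:
  assumes X: "padic_Cauchy CARD('p) X" and Y: "padic_Cauchy CARD('p) Y"
  shows "(padic_of_seq X :: 'p::prime_card padic) = padic_of_seq Y
    \<longleftrightarrow> padic_null CARD('p) (\<lambda>n. X n - Y n)"
proof -
  have "(padic_of_seq X :: 'p padic) = padic_of_seq Y \<longleftrightarrow>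
      {Z. padic_rel CARD('p) X Z} = {Z. padic_rel CARD('p) Y Z}"
    unfolding padic_of_seq_def by (rule Abs_padic_inject) (use X Y in blast)+
  also have "\<dots> \<longleftrightarrow> padic_rel CARD('p) X Y"
    using padic_part_equivp[OF prime_card[where 'a='p]] X Y padic_rel_refl
    by (auto dest: part_equivp_symp part_equivp_transp)
  finally show ?thesis using X Y by (simp add: padic_rel_def)
qed

lemma seq_of_padic_of_seq:
  assumes X: "padic_Cauchy CARD('p) X"
  shows "padic_null CARD('p) (\<lambda>n. seq_of_padic (padic_of_seq X :: 'p::prime_card padic) n - X n)"
  using padic_of_seq_eq_iff[OF Cauchy_seq_of_padic X, of "padic_of_seq X"] by simp

lemma padic_cases:
  obtains X where "padic_Cauchy CARD('p) X" "(x :: 'p::prime_card padic) = padic_of_seq X"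
  using Cauchy_seq_of_padic padic_of_seq_of_padic by metis

instantiation padic :: (prime_card) "{zero, one, plus, uminus, minus, times, inverse}"
begin

definition "0 = padic_of_seq (\<lambda>n. 0)"
definition "1 = padic_of_seq (\<lambda>n. 1)"
definition "x + y = padic_of_seq (\<lambda>n. seq_of_padic x n + seq_of_padic y n)"
definition "- x = padic_of_seq (\<lambda>n. - seq_of_padic x n)"
definition "x - y = x + - (y :: 'a padic)"
definition "x * y = padic_of_seq (\<lambda>n. seq_of_padic x n * seq_of_padic y n)"
definition "inverse x = (if x = 0 then 0 else padic_of_seq (\<lambda>n. inverse (seq_of_padic x n)))"
definition "x div y = x * inverse (y :: 'a padic)"

instance ..

end

lemma padic_of_seq_add:
  assumes X: "padic_Cauchy CARD('p) X" and Y: "padic_Cauchy CARD('p) Y"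
  shows "padic_of_seq X + padic_of_seq Y = (padic_of_seq (\<lambda>n. X n + Y n) :: 'p::prime_card padic)"
proof -
  note p = prime_card[where 'a='p]
  let ?x = "padic_of_seq X :: 'p padic" and ?y = "padic_of_seq Y :: 'p padic"
  have "padic_null CARD('p) (\<lambda>n. (seq_of_padic ?x n - X n) + (seq_of_padic ?y n - Y n))"
    by (intro padic_null_add p seq_of_padic_of_seq X Y)
  thus ?thesis unfolding plus_padic_def
    by (subst padic_of_seq_eq_iff) (auto intro!: padic_Cauchy_add p Cauchy_seq_of_padic X Y simp: algebra_simps)
qed

lemma padic_of_seq_minus:
  assumes X: "padic_Cauchy CARD('p) X"
  shows "- padic_of_seq X = (padic_of_seq (\<lambda>n. - X n) :: 'p::prime_card padic)"
proof -
  note p = prime_card[where 'a='p]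
  let ?x = "padic_of_seq X :: 'p padic"
  have "padic_null CARD('p) (\<lambda>n. - (seq_of_padic ?x n - X n))"
    by (intro padic_null_minus p seq_of_padic_of_seq X)
  thus ?thesis unfolding uminus_padic_def
    by (subst padic_of_seq_eq_iff) (auto intro!: padic_Cauchy_minus p Cauchy_seq_of_padic X simp: algebra_simps)
qed

lemma padic_of_seq_mult:
  assumes X: "padic_Cauchy CARD('p) X" and Y: "padic_Cauchy CARD('p) Y"
  shows "padic_of_seq X * padic_of_seq Y = (padic_of_seq (\<lambda>n. X n * Y n) :: 'p::prime_card padic)"
proof -
  note p = prime_card[where 'a='p]
  let ?x = "padic_of_seq X :: 'p padic" and ?y = "padic_of_seq Y :: 'p padic"
  obtain B where B: "\<And>n. rat_padic_abs CARD('p) (X n) \<le> B" 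
    using padic_Cauchy_bounded[OF p X] by blast
  obtain C where C: "\<And>n. rat_padic_abs CARD('p) (seq_of_padic ?y n) \<le> C" 
    using padic_Cauchy_bounded[OF p Cauchy_seq_of_padic] by blast
  have "padic_null CARD('p) (\<lambda>n. (seq_of_padic ?x n - X n) * seq_of_padic ?y n
      + (seq_of_padic ?y n - Y n) * X n)"
    by (rule padic_null_add[OF p padic_null_bounded_mult[OF p seq_of_padic_of_seq[OF X] C]
      padic_null_bounded_mult[OF p seq_of_padic_of_seq[OF Y] B]])
  thus ?thesis unfolding times_padic_def
    by (subst padic_of_seq_eq_iff) (auto intro!: padic_Cauchy_mult p Cauchy_seq_of_padic X Y simp: algebra_simps)
qed

instance padic :: (prime_card) field
proof
  note p = prime_card[where 'a='a]
  note C = padic_Cauchy_add[OF p] padic_Cauchy_mult[OF p] padic_Cauchy_minus[OF p]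
  note ops = padic_of_seq_add padic_of_seq_mult padic_of_seq_minus zero_padic_def one_padic_def
  fix a b c :: "'a padic"
  obtain X where X: "padic_Cauchy CARD('a) X" "a = padic_of_seq X" by (rule padic_cases)
  obtain Y where Y: "padic_Cauchy CARD('a) Y" "b = padic_of_seq Y" by (rule padic_cases)
  obtain Z where Z: "padic_Cauchy CARD('a) Z" "c = padic_of_seq Z" by (rule padic_cases)
  show "a + b + c = a + (b + c)" "a + b = b + a" "0 + a = a" "- a + a = 0" "a - b = a + - b"
    "a * b * c = a * (b * c)" "a * b = b * a" "1 * a = a" "(a + b) * c = a * c + b * c"
    using X Y Z by (simp_all add: C ops algebra_simps minus_padic_def)
  show "(0 :: 'a padic) \<noteq> 1"
    by (simp add: zero_padic_def one_padic_def padic_of_seq_eq_iff padic_null_def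
        rat_padic_abs_minus[OF p] rat_padic_abs_1[OF p] LIMSEQ_const_iff)
  show "inverse (0 :: 'a padic) = 0" by (simp add: inverse_padic_def)
  show "a div b = a * inverse b" by (simp add: divide_padic_def)
  assume a: "a \<noteq> 0"
  let ?S = "seq_of_padic a"
  have S: "padic_Cauchy CARD('a) ?S" by (rule Cauchy_seq_of_padic)
  have nn: "\<not> padic_null CARD('a) ?S"
    using padic_of_seq_eq_iff[OF S padic_Cauchy_const[of _ 0]] a by (simp add: zero_padic_def)
  note I = padic_Cauchy_inverse[OF p S nn]
  obtain e N where e: "e > 0" "\<And>n. n \<ge> N \<Longrightarrow> rat_padic_abs CARD('a) (?S n) \<ge> e"
    using padic_Cauchy_not_null[OF p S nn] by blast
  have "inverse a * a = padic_of_seq (\<lambda>n. inverse (?S n)) * padic_of_seq ?S"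
    using a by (simp add: inverse_padic_def)
  also have "\<dots> = padic_of_seq (\<lambda>n. inverse (?S n) * ?S n)"
    by (rule padic_of_seq_mult[OF I S])
  also have "\<dots> = padic_of_seq (\<lambda>n. 1)"
  proof (subst padic_of_seq_eq_iff[OF padic_Cauchy_mult[OF p I S] padic_Cauchy_const])
    have "\<forall>\<^sub>F n in sequentially. rat_padic_abs CARD('a) (inverse (?S n) * ?S n - 1) = 0"
    proof (rule eventually_sequentiallyI)
      fix n assume "n \<ge> N"
      hence "?S n \<noteq> 0" using e by fastforce
      thus "rat_padic_abs CARD('a) (inverse (?S n) * ?S n - 1) = 0" by simp
    qed
    thus "padic_null CARD('a) (\<lambda>n. inverse (?S n) * ?S n - 1)"
      unfolding padic_null_def by (rule tendsto_eventually)
  qed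
  finally show "inverse a * a = 1" by (simp add: one_padic_def)
qed

subsection \<open>Absolute value and integers\<close>

definition padic_abs :: "'p::prime_card padic \<Rightarrow> real" where
  "padic_abs x = lim (\<lambda>n. rat_padic_abs CARD('p) (seq_of_padic x n))"

definition padic_integers :: "'p::prime_card padic set" where
  "padic_integers = {x. padic_abs x \<le> 1}"

lemma padic_abs_tendsto:
  fixes X :: "nat \<Rightarrow> rat"
  assumes X: "padic_Cauchy CARD('p) X"
  shows "(\<lambda>n. rat_padic_abs CARD('p) (X n)) \<longlonglongrightarrow> padic_abs (padic_of_seq X :: 'p::prime_card padic)"
proof -
  note p = prime_card[where 'a='p]
  let ?S = "seq_of_padic (padic_of_seq X :: 'p padic)"
  have "Cauchy (\<lambda>n. rat_padic_abs CARD('p) (?S n))"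
    unfolding Cauchy_def dist_real_def using Cauchy_seq_of_padic[of "padic_of_seq X :: 'p padic"]
      rat_padic_abs_diff[OF p] unfolding padic_Cauchy_def by (meson order_le_less_trans)
  hence 1: "(\<lambda>n. rat_padic_abs CARD('p) (?S n)) \<longlonglongrightarrow> padic_abs (padic_of_seq X :: 'p padic)"
    unfolding padic_abs_def by (simp add: real_Cauchy_convergent convergent_LIMSEQ_iff[symmetric])
  have "(\<lambda>n. rat_padic_abs CARD('p) (?S n - X n)) \<longlonglongrightarrow> 0"
    using seq_of_padic_of_seq[OF X] unfolding padic_null_def .
  hence "(\<lambda>n. rat_padic_abs CARD('p) (?S n) - rat_padic_abs CARD('p) (X n)) \<longlonglongrightarrow> 0"
    by (rule tendsto_0_le[where K=1]) (simp add: rat_padic_abs_diff[OF p] rat_padic_abs_nonneg[OF p])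
  from tendsto_diff[OF 1 this] show ?thesis by simp
qed

lemma padic_abs_eq_0_iff: "padic_abs x = 0 \<longleftrightarrow> (x :: 'p::prime_card padic) = 0"
proof -
  have S: "padic_Cauchy CARD('p) (seq_of_padic x)" by (rule Cauchy_seq_of_padic)
  have "x = 0 \<longleftrightarrow> padic_null CARD('p) (seq_of_padic x)"
    using padic_of_seq_eq_iff[OF S padic_Cauchy_const[of _ 0]] by (simp add: zero_padic_def)
  also have "\<dots> \<longleftrightarrow> padic_abs x = 0"
    unfolding padic_null_def using padic_abs_tendsto[OF S] LIMSEQ_unique by fastforce
  finally show ?thesis by simp
qed

lemma padic_abs_of_rat:
  "padic_abs (padic_of_seq (\<lambda>_. r) :: 'p::prime_card padic) = rat_padic_abs CARD('p) r"
  using padic_abs_tendsto[OF padic_Cauchy_const, where 'p='p] LIMSEQ_const_iff by metis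

section \<open>Linear isometries of \<open>\<rat>\<^sub>p\<^sup>d\<close>\<close>

text \<open>Coordinates are indexed by \<open>0, \<dots>, d - 1\<close>.\<close>

definition padic_dist :: "nat \<Rightarrow> 'p::prime_card padic vec \<Rightarrow> 'p padic vec \<Rightarrow> real" where
  "padic_dist d x y = (MAX l\<in>{..<d}. padic_abs (x $ l - y $ l))"

definition deformed_dist ::
    "(nat \<Rightarrow> real) \<Rightarrow> nat \<Rightarrow> 'p::prime_card padic vec \<Rightarrow> 'p padic vec \<Rightarrow> real" where
  "deformed_dist q d x y = (MAX l\<in>{..<d}. q l * padic_abs (x $ l - y $ l))"

text \<open>
  A linear transformation of \<open>K\<^sup>d\<close> is identified with its matrix, which acts on column vectors.
  Linear maps preserving a metric are injective, hence invertible, so that invertibility does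
  not have to be required.
\<close>

definition linear_isometry_group ::
    "nat \<Rightarrow> ('a::field vec \<Rightarrow> 'a vec \<Rightarrow> real) \<Rightarrow> 'a mat monoid" where
  "linear_isometry_group d \<rho> =
    \<lparr>carrier = {A \<in> carrier_mat d d. \<forall>x\<in>carrier_vec d. \<forall>y\<in>carrier_vec d.
        \<rho> (A *\<^sub>v x) (A *\<^sub>v y) = \<rho> x y},
     monoid.mult = (*), one = 1\<^sub>m d\<rparr>"

definition padic_orthogonal_group :: "nat \<Rightarrow> 'p::prime_card padic mat monoid" where
  "padic_orthogonal_group d = linear_isometry_group d (padic_dist d)"

lemma group_linear_isometry_group:
  fixes \<rho> :: "'a::field vec \<Rightarrow> 'a vec \<Rightarrow> real"
  assumes zero: "\<And>x y. x \<in> carrier_vec d \<Longrightarrow> y \<in> carrier_vec d \<Longrightarrow> \<rho> x y = 0 \<longleftrightarrow> x = y"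
  shows "group (linear_isometry_group d \<rho>)"
proof (rule groupI)
  let ?G = "linear_isometry_group d \<rho>"
  fix A assume A: "A \<in> carrier ?G"
  hence Ac: "A \<in> carrier_mat d d" and iso: "\<And>x y. x \<in> carrier_vec d \<Longrightarrow> y \<in> carrier_vec d \<Longrightarrow>
      \<rho> (A *\<^sub>v x) (A *\<^sub>v y) = \<rho> x y"
    by (auto simp: linear_isometry_group_def)
  have "det A \<noteq> 0"
  proof
    assume "det A = 0"
    then obtain v where v: "v \<in> carrier_vec d" "v \<noteq> 0\<^sub>v d" "A *\<^sub>v v = 0\<^sub>v d"
      using det_0_iff_vec_prod_zero_field[OF Ac] by blast
    have "A *\<^sub>v 0\<^sub>v d = 0\<^sub>v d" using Ac by auto
    hence "\<rho> v (0\<^sub>v d) = \<rho> (0\<^sub>v d) (0\<^sub>v d)" using iso[OF v(1), of "0\<^sub>v d"] v(3) by simp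
    thus False using zero v by (metis zero_carrier_vec)
  qed
  from det_non_zero_imp_unit[OF Ac this, of "()"]
  obtain B where B: "B \<in> carrier_mat d d" "B * A = 1\<^sub>m d" "A * B = 1\<^sub>m d"
    unfolding Units_def by (auto simp: ring_mat_def)
  have "\<rho> (B *\<^sub>v x) (B *\<^sub>v y) = \<rho> x y" if x: "x \<in> carrier_vec d" and y: "y \<in> carrier_vec d" for x y
  proof -
    have "A *\<^sub>v (B *\<^sub>v x) = x" "A *\<^sub>v (B *\<^sub>v y) = y"
      using assoc_mult_mat_vec[OF Ac B(1)] x y B(3) by (metis one_mult_mat_vec)+
    thus ?thesis using iso[of "B *\<^sub>v x" "B *\<^sub>v y"] B(1) x y by simp
  qed
  thus "\<exists>B\<in>carrier ?G. B \<otimes>\<^bsub>?G\<^esub> A = \<one>\<^bsub>?G\<^esub>"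
    using B by (auto simp: linear_isometry_group_def)
qed (auto simp: linear_isometry_group_def assoc_mult_mat[where n\<^sub>1=d and n\<^sub>2=d and n\<^sub>3=d and n\<^sub>4=d]
    assoc_mult_mat_vec[where n\<^sub>1=d and n\<^sub>2=d and n\<^sub>3=d])

lemma group_padic_orthogonal_group:
  assumes "d \<ge> 1"
  shows "group (padic_orthogonal_group d :: 'p::prime_card padic mat monoid)"
  unfolding padic_orthogonal_group_def
proof (rule group_linear_isometry_group)
  note p = prime_card[where 'a='p]
  fix x y :: "'p padic vec" assume x: "x \<in> carrier_vec d" and y: "y \<in> carrier_vec d"
  have nonneg: "padic_abs z \<ge> 0" for z :: "'p padic"
    using padic_abs_tendsto[OF Cauchy_seq_of_padic[of z]] rat_padic_abs_nonneg[OF p]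
    by (auto intro: LIMSEQ_le_const)
  let ?S = "(\<lambda>l. padic_abs (x $ l - y $ l)) ` {..<d}"
  have S: "finite ?S" "?S \<noteq> {}" using assms by (auto simp: lessThan_empty_iff)
  have "Max ?S = 0 \<longleftrightarrow> (\<forall>l<d. padic_abs (x $ l - y $ l) = 0)"
    using Max_ge[OF S(1)] Max_in[OF S] nonneg by (auto intro: antisym simp: Max_eq_iff[OF S])
  also have "\<dots> \<longleftrightarrow> x = y" using x y by (auto simp: padic_abs_eq_0_iff)
  finally show "padic_dist d x y = 0 \<longleftrightarrow> x = y" unfolding padic_dist_def .
qed

end

theory Submission
  imports Defs
begin

text \<open>
  Both metrics come from norms \<open>max q l * \<bar>x l\<bar>\<close>, the standard one having all weights equal to \<open>1\<close>.
  Over an ultrametric field, a matrix is a contraction for such a norm exactly when its entries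
  satisfy \<open>q a * \<bar>A a b\<bar> \<le> q b\<close> (\<open>weighted_contraction_iff\<close>), and it is an isometry exactly when it
  has an inverse and both it and the inverse are contractions (\<open>deformed_isometry_iff\<close>).

  Absolute values are powers of \<open>p\<close>, and the ratios of the weights lie strictly between \<open>p\<^sup>-\<^sup>1\<close> and
  \<open>p\<close>. Hence, for increasing weights, the entrywise bounds say precisely that the matrix is integral
  and upper triangular modulo \<open>p\<close> (\<open>weighted_bounded_iff_upper_triangular_mod_prime\<close>), whereas for
  weights \<open>1\<close> they say that it is integral. So the isometries of the deformed metric are the
  matrices that, together with their inverses, are integral and upper triangular modulo \<open>p\<close>. An
  element of \<open>O\<^sub>d\<close> and its inverse are integral already, and an integral inverse inherits
  triangularity modulo \<open>p\<close>
  (\<open>inverse_upper_triangular_mod_prime\<close>).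
\<close>

section \<open>The absolute value on the field of p-adic numbers\<close>

lemma padic_abs_nonneg: "padic_abs (x :: 'p::prime_card padic) \<ge> 0"
  using padic_abs_tendsto[OF Cauchy_seq_of_padic[of x]] rat_padic_abs_nonneg[OF prime_card[where 'a='p]]
  by (auto intro: LIMSEQ_le_const)

lemma padic_abs_0 [simp]: "padic_abs (0 :: 'p::prime_card padic) = 0"
  by (simp add: padic_abs_eq_0_iff)

lemma padic_abs_mult: "padic_abs (x * y :: 'p::prime_card padic) = padic_abs x * padic_abs y"
proof -
  note p = prime_card[where 'a='p]
  obtain X where X: "padic_Cauchy CARD('p) X" "x = padic_of_seq X" by (rule padic_cases)
  obtain Y where Y: "padic_Cauchy CARD('p) Y" "y = padic_of_seq Y" by (rule padic_cases)
  have "(\<lambda>n. rat_padic_abs CARD('p) (X n * Y n)) \<longlonglongrightarrow> padic_abs x * padic_abs y"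
    unfolding rat_padic_abs_mult[OF p] X(2) Y(2)
    by (intro tendsto_mult padic_abs_tendsto X Y)
  moreover have "(\<lambda>n. rat_padic_abs CARD('p) (X n * Y n)) \<longlonglongrightarrow> padic_abs (x * y)"
    unfolding X(2) Y(2) padic_of_seq_mult[OF X(1) Y(1)]
    by (intro padic_abs_tendsto padic_Cauchy_mult p X Y)
  ultimately show ?thesis using LIMSEQ_unique by blast
qed

lemma padic_abs_add: "padic_abs (x + y :: 'p::prime_card padic) \<le> max (padic_abs x) (padic_abs y)"
proof -
  note p = prime_card[where 'a='p]
  obtain X where X: "padic_Cauchy CARD('p) X" "x = padic_of_seq X" by (rule padic_cases)
  obtain Y where Y: "padic_Cauchy CARD('p) Y" "y = padic_of_seq Y" by (rule padic_cases)
  have "(\<lambda>n. max (rat_padic_abs CARD('p) (X n)) (rat_padic_abs CARD('p) (Y n)))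
      \<longlonglongrightarrow> max (padic_abs x) (padic_abs y)"
    unfolding X(2) Y(2) by (intro tendsto_max padic_abs_tendsto X Y)
  moreover have "(\<lambda>n. rat_padic_abs CARD('p) (X n + Y n)) \<longlonglongrightarrow> padic_abs (x + y)"
    unfolding X(2) Y(2) padic_of_seq_add[OF X(1) Y(1)]
    by (intro padic_abs_tendsto padic_Cauchy_add p X Y)
  ultimately show ?thesis using rat_padic_abs_add[OF p] by (auto intro: LIMSEQ_le)
qed

lemma padic_abs_1: "padic_abs (1 :: 'p::prime_card padic) = 1"
  by (simp add: one_padic_def padic_abs_of_rat rat_padic_abs_1 prime_card)

lemma padic_abs_minus: "padic_abs (- x :: 'p::prime_card padic) = padic_abs x"
proof -
  have "padic_abs (-1 :: 'p padic) * padic_abs (-1 :: 'p padic) = 1"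
    using padic_abs_mult[of "-1 :: 'p padic" "-1"] by (simp add: padic_abs_1)
  hence "padic_abs (-1 :: 'p padic) = 1"
    using padic_abs_nonneg[of "-1 :: 'p padic"] by (simp add: square_eq_1_iff)
  thus ?thesis using padic_abs_mult[of "-1" x] by simp
qed

lemma padic_abs_sum_le:
  fixes f :: "'i \<Rightarrow> 'p::prime_card padic"
  assumes "c \<ge> 0" and "\<And>i. i \<in> I \<Longrightarrow> padic_abs (f i) \<le> c"
  shows "padic_abs (sum f I) \<le> c"
  using assms(2)
proof (induction I rule: infinite_finite_induct)
  case (insert i I)
  have "padic_abs (f i) \<le> c" "padic_abs (sum f I) \<le> c" using insert by auto
  thus ?case using insert(1,2) padic_abs_add[of "f i" "sum f I"] by simp
qed (simp_all add: assms(1))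

lemma padic_of_nat: "(of_nat n :: 'p::prime_card padic) = padic_of_seq (\<lambda>_. of_nat n)"
  by (induction n) (simp_all add: zero_padic_def one_padic_def padic_of_seq_add)

lemma padic_abs_prime: "padic_abs (of_nat CARD('p) :: 'p::prime_card padic) = 1 / real CARD('p)"
proof -
  note p = prime_card[where 'a='p]
  have "rat_padic_abs CARD('p) (of_int (int CARD('p)) / of_int 1) =
      real CARD('p) powi (int (multiplicity (int CARD('p)) 1)
        - int (multiplicity (int CARD('p)) (int CARD('p))))"
    by (rule rat_padic_abs_frac[OF p]) auto
  also have "multiplicity (int CARD('p)) (int CARD('p)) = 1"
    using prime_gt_1_nat[OF p] by (intro multiplicity_self) auto
  finally show ?thesis
    by (simp add: padic_of_nat padic_abs_of_rat power_int_minus field_simps)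
qed

text \<open>
  The value group is the discrete group of powers of \<open>p\<close>. For a rational number this is visible
  in the definition of its absolute value, and the bound passes to limits.
\<close>

lemma padic_abs_less_1_iff:
  "padic_abs (x :: 'p::prime_card padic) < 1 \<longleftrightarrow> padic_abs x \<le> 1 / real CARD('p)"
proof
  note p = prime_card[where 'a='p]
  have p1: "real CARD('p) > 1" using prime_gt_1_nat[OF p] by simp
  have rat: "rat_padic_abs CARD('p) r \<le> 1 / real CARD('p)" if r: "rat_padic_abs CARD('p) r < 1" for r
  proof (cases "r = 0")
    case False
    then have "\<exists>k. rat_padic_abs CARD('p) r = real CARD('p) powi k"
      unfolding rat_padic_abs_def by (cases "quotient_of r") auto
    then obtain k where k: "rat_padic_abs CARD('p) r = real CARD('p) powi k" ..
    have "k < 0"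
    proof (rule ccontr)
      assume "\<not> k < 0"
      hence "real CARD('p) powi k \<ge> 1" using p1 by (intro one_le_power_int) auto
      thus False using r k by simp
    qed
    hence "real CARD('p) powi k \<le> real CARD('p) powi (-1)"
      using p1 by (intro power_int_increasing) auto
    thus ?thesis using k by (simp add: power_int_minus field_simps)
  qed simp
  obtain X where X: "padic_Cauchy CARD('p) X" "x = padic_of_seq X" by (rule padic_cases)
  have lim: "(\<lambda>n. rat_padic_abs CARD('p) (X n)) \<longlonglongrightarrow> padic_abs x"
    unfolding X(2) by (rule padic_abs_tendsto[OF X(1)])
  assume "padic_abs x < 1"
  hence "\<forall>\<^sub>F n in sequentially. rat_padic_abs CARD('p) (X n) < 1"
    using order_tendstoD(2)[OF lim] by blast
  hence "\<forall>\<^sub>F n in sequentially. rat_padic_abs CARD('p) (X n) \<le> 1 / real CARD('p)"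
    by (rule eventually_mono) (rule rat)
  thus "padic_abs x \<le> 1 / real CARD('p)"
    by (rule tendsto_upperbound[OF lim]) simp
next
  assume "padic_abs x \<le> 1 / real CARD('p)"
  also have "1 / real CARD('p) < 1" using prime_gt_1_nat[OF prime_card[where 'a='p]] by simp
  finally show "padic_abs x < 1" .
qed

lemma padic_prime_multiple_iff:
  "(\<exists>z\<in>padic_integers. x = of_nat CARD('p) * z) \<longleftrightarrow> padic_abs (x :: 'p::prime_card padic) < 1"
proof
  have p0: "real CARD('p) > 0" using prime_gt_0_nat[OF prime_card[where 'a='p]] by simp
  {
    assume "\<exists>z\<in>padic_integers. x = of_nat CARD('p) * z"
    then show "padic_abs x < 1"
      unfolding padic_abs_less_1_iff using p0
      by (auto simp: padic_integers_def padic_abs_mult padic_abs_prime divide_right_mono)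
  }
  assume "padic_abs x < 1"
  hence le: "padic_abs x \<le> 1 / real CARD('p)" by (simp add: padic_abs_less_1_iff)
  have ne: "(of_nat CARD('p) :: 'p padic) \<noteq> 0"
    using padic_abs_prime[where 'p='p] p0 by (metis padic_abs_0 divide_eq_0_iff less_irrefl zero_neq_one)
  hence x: "x = of_nat CARD('p) * (x / of_nat CARD('p))" by simp
  have "padic_abs x = 1 / real CARD('p) * padic_abs (x / of_nat CARD('p))"
    by (subst x) (simp only: padic_abs_mult padic_abs_prime)
  hence "padic_abs (x / of_nat CARD('p)) \<le> 1" using le p0 by (simp add: field_simps)
  thus "\<exists>z\<in>padic_integers. x = of_nat CARD('p) * z"
    using x unfolding padic_integers_def by blast
qed

text \<open>Division by \<open>p\<close> shifts the gap between \<open>p\<^sup>-\<^sup>1\<close> and \<open>1\<close> to the one between \<open>1\<close> and \<open>p\<close>.\<close>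

lemma padic_abs_less_prime_imp_le_1:
  assumes "padic_abs (x :: 'p::prime_card padic) < real CARD('p)"
  shows "padic_abs x \<le> 1"
proof -
  have p0: "real CARD('p) > 0" using prime_gt_0_nat[OF prime_card[where 'a='p]] by simp
  have "padic_abs (of_nat CARD('p) * x) < 1"
    using assms p0 by (simp add: padic_abs_mult padic_abs_prime field_simps)
  hence "padic_abs (of_nat CARD('p) * x) \<le> 1 / real CARD('p)"
    by (simp only: padic_abs_less_1_iff)
  thus ?thesis using p0 by (simp add: padic_abs_mult padic_abs_prime field_simps)
qed

section \<open>Isometries of a weighted maximum metric\<close>

definition weighted_norm :: "(nat \<Rightarrow> real) \<Rightarrow> nat \<Rightarrow> 'p::prime_card padic vec \<Rightarrow> real" where
  "weighted_norm q d x = (MAX l\<in>{..<d}. q l * padic_abs (x $ l))"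

lemma deformed_dist_eq_weighted_norm:
  "x \<in> carrier_vec d \<Longrightarrow> y \<in> carrier_vec d \<Longrightarrow> deformed_dist q d x y = weighted_norm q d (x - y)"
  unfolding deformed_dist_def weighted_norm_def by (intro arg_cong[where f=Max] image_cong) auto

lemma padic_dist_eq_deformed_dist: "padic_dist d = deformed_dist (\<lambda>_. 1) d"
  by (simp add: padic_dist_def deformed_dist_def fun_eq_iff)

lemma weighted_norm_ge: "l < d \<Longrightarrow> q l * padic_abs (x $ l) \<le> weighted_norm q d x"
  unfolding weighted_norm_def by (intro Max_ge) auto

lemma weighted_norm_leI:
  assumes "d \<ge> 1" and "\<And>l. l < d \<Longrightarrow> q l * padic_abs (x $ l) \<le> c"
  shows "weighted_norm q d x \<le> c"
  unfolding weighted_norm_def using assms by (intro Max.boundedI) (auto simp: lessThan_empty_iff)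

definition weighted_bounded :: "(nat \<Rightarrow> real) \<Rightarrow> nat \<Rightarrow> 'p::prime_card padic mat \<Rightarrow> bool" where
  "weighted_bounded q d A \<longleftrightarrow> (\<forall>a<d. \<forall>b<d. q a * padic_abs (A $$ (a, b)) \<le> q b)"

text \<open>
  For a weighted maximum norm over an ultrametric field, the operator norm of \<open>A\<close> is the maximum of
  \<open>q a * \<bar>A a b\<bar> / q b\<close> over the entries: the images of the coordinate vectors bound each entry, and the ultrametric inequality gives the
  converse.
\<close>

lemma weighted_contraction_iff:
  fixes A :: "'p::prime_card padic mat"
  assumes d: "d \<ge> 1" and q: "\<And>l. l < d \<Longrightarrow> q l > 0" and A: "A \<in> carrier_mat d d"
  shows "(\<forall>x\<in>carrier_vec d. weighted_norm q d (A *\<^sub>v x) \<le> weighted_norm q d x)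
    \<longleftrightarrow> weighted_bounded q d A"
proof
  assume contr: "\<forall>x\<in>carrier_vec d. weighted_norm q d (A *\<^sub>v x) \<le> weighted_norm q d x"
  show "weighted_bounded q d A"
    unfolding weighted_bounded_def
  proof (intro allI impI)
    fix a b assume ab: "a < d" "b < d"
    let ?e = "unit_vec d b :: 'p padic vec"
    have "q a * padic_abs (A $$ (a, b)) = q a * padic_abs ((A *\<^sub>v ?e) $ a)"
      using A ab by simp
    also have "\<dots> \<le> weighted_norm q d (A *\<^sub>v ?e)"
      by (rule weighted_norm_ge[OF ab(1)])
    also have "\<dots> \<le> weighted_norm q d ?e"
      using contr unit_vec_carrier by blast
    also have "\<dots> \<le> q b"
      using q[OF ab(2)] ab by (intro weighted_norm_leI d) (auto simp: unit_vec_def padic_abs_1)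
    finally show "q a * padic_abs (A $$ (a, b)) \<le> q b" .
  qed
next
  assume bnd: "weighted_bounded q d A"
  show "\<forall>x\<in>carrier_vec d. weighted_norm q d (A *\<^sub>v x) \<le> weighted_norm q d x"
  proof (intro ballI weighted_norm_leI d)
    fix x :: "'p padic vec" and a assume x: "x \<in> carrier_vec d" and a: "a < d"
    let ?N = "weighted_norm q d x"
    have term_le: "padic_abs (A $$ (a, b) * x $ b) \<le> ?N / q a" if b: "b < d" for b
    proof -
      have "q a * padic_abs (A $$ (a, b) * x $ b) = (q a * padic_abs (A $$ (a, b))) * padic_abs (x $ b)"
        by (simp add: padic_abs_mult)
      also have "\<dots> \<le> q b * padic_abs (x $ b)"
        using bnd a b by (intro mult_right_mono padic_abs_nonneg) (auto simp: weighted_bounded_def)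
      also have "\<dots> \<le> ?N" by (rule weighted_norm_ge[OF b])
      finally show ?thesis using q[OF a] by (simp add: field_simps)
    qed
    have "(A *\<^sub>v x) $ a = (\<Sum>b<d. A $$ (a, b) * x $ b)"
      using A x a by (auto simp: scalar_prod_def lessThan_atLeast0 intro!: sum.cong)
    also have "padic_abs \<dots> \<le> ?N / q a"
    proof (rule padic_abs_sum_le)
      show "0 \<le> ?N / q a"
        using term_le[OF a] padic_abs_nonneg order_trans by blast
    qed (use term_le in auto)
    finally show "q a * padic_abs ((A *\<^sub>v x) $ a) \<le> ?N" using q[OF a] by (simp add: field_simps)
  qed
qed

lemma group_deformed_isometries:
  assumes d: "d \<ge> 1" and q: "\<And>l. l < d \<Longrightarrow> q l > 0"
  shows "group (linear_isometry_group d (deformed_dist q d) :: 'p::prime_card padic mat monoid)"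
proof (rule group_linear_isometry_group)
  fix x y :: "'p padic vec" assume x: "x \<in> carrier_vec d" and y: "y \<in> carrier_vec d"
  have "x = y" if "deformed_dist q d x y = 0"
  proof (rule eq_vecI)
    fix l assume "l < dim_vec y"
    hence l: "l < d" using y by simp
    have "q l * padic_abs ((x - y) $ l) \<le> 0"
      using weighted_norm_ge[OF l, of q "x - y"] that
      by (simp add: deformed_dist_eq_weighted_norm[OF x y])
    hence "padic_abs (x $ l - y $ l) = 0"
      using q[OF l] x y l padic_abs_nonneg[of "x $ l - y $ l"] by (auto simp: mult_le_0_iff)
    thus "x $ l = y $ l" by (simp add: padic_abs_eq_0_iff)
  qed (use x y in auto)
  moreover have "deformed_dist q d x x = 0"
  proof -
    have "(\<lambda>l. q l * padic_abs (x $ l - x $ l)) ` {..<d} = {0}"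
      using d by (auto simp: image_constant_conv lessThan_empty_iff)
    thus ?thesis unfolding deformed_dist_def by simp
  qed
  ultimately show "deformed_dist q d x y = 0 \<longleftrightarrow> x = y" by blast
qed

text \<open>
  A linear bijection is an isometry exactly when it and its inverse are contractions. The inverse
  of an isometry is available because the isometries form a group.
\<close>

lemma deformed_isometry_iff:
  fixes A :: "'p::prime_card padic mat"
  assumes d: "d \<ge> 1" and q: "\<And>l. l < d \<Longrightarrow> q l > 0"
  shows "A \<in> carrier (linear_isometry_group d (deformed_dist q d)) \<longleftrightarrow>
    A \<in> carrier_mat d d \<and> weighted_bounded q d A \<and>
    (\<exists>B\<in>carrier_mat d d. weighted_bounded q d B \<and> B * A = 1\<^sub>m d)"
    (is "A \<in> carrier ?G \<longleftrightarrow> ?R")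
proof
  have bounded: "C \<in> carrier_mat d d \<and> weighted_bounded q d C" if C: "C \<in> carrier ?G" for C
  proof -
    have Cc: "C \<in> carrier_mat d d" using C by (simp add: linear_isometry_group_def)
    have "weighted_norm q d (C *\<^sub>v x) = weighted_norm q d x" if x: "x \<in> carrier_vec d" for x
    proof -
      have "C *\<^sub>v 0\<^sub>v d = 0\<^sub>v d" using Cc by auto
      moreover have "deformed_dist q d (C *\<^sub>v x) (C *\<^sub>v 0\<^sub>v d) = deformed_dist q d x (0\<^sub>v d)"
        using C x by (simp add: linear_isometry_group_def)
      moreover have "C *\<^sub>v x \<in> carrier_vec d" using Cc x by simp
      ultimately show ?thesis using x by (simp add: deformed_dist_eq_weighted_norm)
    qed
    thus ?thesis using weighted_contraction_iff[where q=q, OF d q Cc] Cc by simp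
  qed
  {
    assume A: "A \<in> carrier ?G"
    interpret group ?G by (rule group_deformed_isometries[where q=q, OF d q])
    have "inv\<^bsub>?G\<^esub> A * A = 1\<^sub>m d" using l_inv[OF A] by (simp add: linear_isometry_group_def)
    thus ?R using bounded[OF A] bounded[OF inv_closed[OF A]] by blast
  }
  assume ?R
  then obtain B where A: "A \<in> carrier_mat d d" "weighted_bounded q d A"
    and B: "B \<in> carrier_mat d d" "weighted_bounded q d B" "B * A = 1\<^sub>m d" by blast
  have norm: "weighted_norm q d (A *\<^sub>v x) = weighted_norm q d x" if x: "x \<in> carrier_vec d" for x
  proof (rule antisym)
    show "weighted_norm q d (A *\<^sub>v x) \<le> weighted_norm q d x"
      using weighted_contraction_iff[where q=q, OF d q A(1)] A(2) x by blast
    have "x = B *\<^sub>v (A *\<^sub>v x)"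
      using assoc_mult_mat_vec[OF B(1) A(1) x] B(3) x by simp
    moreover have "weighted_norm q d (B *\<^sub>v (A *\<^sub>v x)) \<le> weighted_norm q d (A *\<^sub>v x)"
      using weighted_contraction_iff[where q=q, OF d q B(1)] B(2) A(1) x by simp
    ultimately show "weighted_norm q d x \<le> weighted_norm q d (A *\<^sub>v x)" by simp
  qed
  have "deformed_dist q d (A *\<^sub>v x) (A *\<^sub>v y) = deformed_dist q d x y"
    if x: "x \<in> carrier_vec d" and y: "y \<in> carrier_vec d" for x y
  proof -
    have "A *\<^sub>v x \<in> carrier_vec d" "A *\<^sub>v y \<in> carrier_vec d" using A(1) x y by auto
    thus ?thesis
      using x y norm[of "x - y"] mult_minus_distrib_mat_vec[OF A(1) x y]
      by (simp add: deformed_dist_eq_weighted_norm)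
  qed
  thus "A \<in> carrier ?G" using A(1) by (simp add: linear_isometry_group_def)
qed

section \<open>Matrices that are upper triangular modulo p\<close>

text \<open>
  This is where \<open>p\<^sup>-\<^sup>1 < q l \<le> 1\<close> enters: every ratio \<open>q b / q a\<close> lies strictly between \<open>p\<^sup>-\<^sup>1\<close> and
  \<open>p\<close>, so, absolute values being powers of \<open>p\<close>, the bound \<open>q b / q a\<close> on an entry amounts to the
  bound \<open>1\<close> if the ratio is at least \<open>1\<close>, and to the bound \<open>p\<^sup>-\<^sup>1\<close> if it is less than \<open>1\<close>.
\<close>

lemma weighted_bounded_iff_upper_triangular_mod_prime:
  fixes A :: "'p::prime_card padic mat"
  assumes mono: "strict_mono_on {..<d} q"
    and range: "\<And>l. l < d \<Longrightarrow> q l \<in> {1 / real CARD('p)<..1}"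
  shows "weighted_bounded q d A \<longleftrightarrow>
    weighted_bounded (\<lambda>_. 1) d A \<and> (\<forall>a<d. \<forall>b<a. padic_abs (A $$ (a, b)) < 1)"
proof -
  have p0: "real CARD('p) > 0" using prime_gt_0_nat[OF prime_card[where 'a='p]] by simp
  have pos: "q l > 0" if "l < d" for l
  proof -
    have "1 / real CARD('p) < q l" using range[OF that] by simp
    thus ?thesis using p0 by (meson less_trans zero_less_divide_1_iff)
  qed
  have entry: "q a * padic_abs (A $$ (a, b)) \<le> q b \<longleftrightarrow>
      padic_abs (A $$ (a, b)) \<le> 1 \<and> (b < a \<longrightarrow> padic_abs (A $$ (a, b)) < 1)"
    if ab: "a < d" "b < d" for a b
  proof
    let ?t = "padic_abs (A $$ (a, b))"
    {
      assume le: "q a * ?t \<le> q b"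
      have "q a * real CARD('p) > 1" using range[OF ab(1)] p0 by (simp add: field_simps)
      hence "q a * ?t < q a * real CARD('p)" using le range[OF ab(2)] by simp
      hence "?t \<le> 1" using pos[OF ab(1)] by (intro padic_abs_less_prime_imp_le_1) simp
      moreover have "?t < 1" if "b < a"
      proof -
        have "q b < q a" using mono ab that by (auto simp: strict_mono_on_def)
        hence "q a * ?t < q a * 1" using le by simp
        thus ?thesis using pos[OF ab(1)] by (simp only: mult_less_cancel_left_pos)
      qed
      ultimately show "?t \<le> 1 \<and> (b < a \<longrightarrow> ?t < 1)" by simp
    next
      assume t: "?t \<le> 1 \<and> (b < a \<longrightarrow> ?t < 1)"
      show "q a * ?t \<le> q b"
      proof (cases "b < a")
        case True
        hence "?t \<le> 1 / real CARD('p)" using t by (simp add: padic_abs_less_1_iff)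
        hence "q a * ?t \<le> 1 * (1 / real CARD('p))"
          using range[OF ab(1)] padic_abs_nonneg by (intro mult_mono) auto
        thus ?thesis using range[OF ab(2)] by simp
      next
        case False
        hence "q a \<le> q b" using mono ab
          by (cases "a = b") (auto simp: strict_mono_on_def intro: less_imp_le)
        moreover have "q a * ?t \<le> q a * 1" using t pos[OF ab(1)] by (intro mult_left_mono) auto
        ultimately show ?thesis by simp
      qed
    }
  qed
  show ?thesis
    unfolding weighted_bounded_def using entry by (auto intro: less_trans)
qed

text \<open>
  Modulo \<open>p\<close> an integral inverse of an upper triangular matrix is upper triangular. Induct on the
  column \<open>b\<close>. In the entry \<open>(i, b)\<close> of \<open>B * A = 1\<close> with \<open>i \<ge> b\<close>, the summands \<open>B i j * A j b\<close> vanish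
  modulo \<open>p\<close> for \<open>j < b\<close> by the induction hypothesis and for \<open>j > b\<close> by the assumption on \<open>A\<close>, which
  leaves \<open>B i b * A b b\<close> congruent to the Kronecker delta. The case \<open>i = b\<close> makes the diagonal entry
  of \<open>A\<close> a unit, and then the case \<open>i > b\<close> puts \<open>B i b\<close> into the maximal ideal.
\<close>

lemma inverse_upper_triangular_mod_prime:
  fixes A B :: "'p::prime_card padic mat"
  assumes A: "A \<in> carrier_mat d d" "weighted_bounded (\<lambda>_. 1) d A"
    and B: "B \<in> carrier_mat d d" "weighted_bounded (\<lambda>_. 1) d B"
    and BA: "B * A = 1\<^sub>m d"
    and upper: "\<And>a b. a < d \<Longrightarrow> b < a \<Longrightarrow> padic_abs (A $$ (a, b)) < 1"
    and i: "i < d" and b: "b < i"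
  shows "padic_abs (B $$ (i, b)) < 1"
proof -
  have Ale: "padic_abs (A $$ (j, k)) \<le> 1" and Ble: "padic_abs (B $$ (j, k)) \<le> 1"
    if "j < d" "k < d" for j k
    using that A(2) B(2) by (auto simp: weighted_bounded_def)
  have small: "padic_abs (x * y) < 1"
    if "padic_abs x < 1" "padic_abs y \<le> 1" for x y :: "'p padic"
  proof -
    have "padic_abs (x * y) \<le> padic_abs x * 1"
      unfolding padic_abs_mult using that by (intro mult_left_mono padic_abs_nonneg)
    thus ?thesis using that by simp
  qed
  from b i show ?thesis
  proof (induction b arbitrary: i rule: less_induct)
    case (less b)
    have bd: "b < d" using less.prems by simp
    have delta: "padic_abs ((1\<^sub>m d) $$ (k, b) - B $$ (k, b) * A $$ (b, b)) < 1"
      if k: "k < d" "b \<le> k" for k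
    proof -
      have "(1\<^sub>m d) $$ (k, b) = (\<Sum>j<d. B $$ (k, j) * A $$ (j, b))"
        unfolding BA[symmetric] using A(1) B(1) k(1) bd
        by (auto simp: scalar_prod_def lessThan_atLeast0 intro!: sum.cong)
      also have "\<dots> = B $$ (k, b) * A $$ (b, b) + (\<Sum>j\<in>{..<d} - {b}. B $$ (k, j) * A $$ (j, b))"
        using bd by (intro sum.remove) auto
      finally have "(1\<^sub>m d) $$ (k, b) - B $$ (k, b) * A $$ (b, b) =
          (\<Sum>j\<in>{..<d} - {b}. B $$ (k, j) * A $$ (j, b))" by simp
      also have "padic_abs \<dots> \<le> 1 / real CARD('p)"
      proof (rule padic_abs_sum_le)
        fix j assume j: "j \<in> {..<d} - {b}"
        have "padic_abs (B $$ (k, j) * A $$ (j, b)) < 1"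
        proof (cases "j < b")
          case True
          thus ?thesis using less.IH[of j k] k bd Ale[of j b] by (intro small) auto
        next
          case False
          thus ?thesis using j upper[of j b] small[of "A $$ (j, b)" "B $$ (k, j)"] k Ble[of k j]
            by (simp add: mult.commute)
        qed
        thus "padic_abs (B $$ (k, j) * A $$ (j, b)) \<le> 1 / real CARD('p)"
          by (simp only: padic_abs_less_1_iff)
      qed simp
      finally show ?thesis by (simp only: padic_abs_less_1_iff)
    qed
    have unit: "padic_abs (A $$ (b, b)) = 1"
    proof (rule ccontr)
      assume "padic_abs (A $$ (b, b)) \<noteq> 1"
      hence "padic_abs (A $$ (b, b)) < 1" using Ale[OF bd bd] by simp
      hence "padic_abs (B $$ (b, b) * A $$ (b, b)) < 1"
        using small[OF _ Ble[OF bd bd]] by (simp add: mult.commute)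
      hence "padic_abs (1 :: 'p padic) < 1"
        using delta[OF bd order_refl] bd
          padic_abs_add[of "1 - B $$ (b, b) * A $$ (b, b)" "B $$ (b, b) * A $$ (b, b)"] by simp
      thus False by (simp add: padic_abs_1)
    qed
    have "padic_abs (- (B $$ (i, b) * A $$ (b, b))) < 1"
      using delta[of i] less.prems bd by simp
    moreover have "padic_abs (B $$ (i, b) * A $$ (b, b)) = padic_abs (- (B $$ (i, b) * A $$ (b, b)))"
      by (rule padic_abs_minus[symmetric])
    ultimately show ?case by (simp add: padic_abs_mult unit)
  qed
qed

section \<open>The isometry group of the deformed metric\<close>

theorem lemma2:
  fixes d :: nat and q :: "nat \<Rightarrow> real"
  assumes "d \<ge> 1"
    and "strict_mono_on {..<d} q"
    and "\<And>l. l < d \<Longrightarrow> q l \<in> {1 / real CARD('p)<..1}"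
  shows "subgroup (carrier (linear_isometry_group d (deformed_dist q d)))
      (padic_orthogonal_group d :: 'p::prime_card padic mat monoid) \<and>
    carrier (linear_isometry_group d (deformed_dist q d)) =
      {A \<in> carrier (padic_orthogonal_group d :: 'p padic mat monoid).
        \<forall>a<d. \<forall>b<a. \<exists>z\<in>padic_integers. A $$ (a, b) = of_nat CARD('p) * z}"
proof -
  let ?G = "linear_isometry_group d (deformed_dist q d) :: 'p padic mat monoid"
  let ?O = "padic_orthogonal_group d :: 'p padic mat monoid"
  have pos: "q l > 0" if "l < d" for l
  proof -
    have "1 / real CARD('p) < q l" using assms(3)[OF that] by simp
    moreover have "0 \<le> 1 / real CARD('p)" by simp
    ultimately show ?thesis by (rule le_less_trans[rotated])
  qed
  have G_iff: "A \<in> carrier ?G \<longleftrightarrow> A \<in> carrier_mat d d \<and> weighted_bounded q d A \<and>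
      (\<exists>B\<in>carrier_mat d d. weighted_bounded q d B \<and> B * A = 1\<^sub>m d)" for A
    by (rule deformed_isometry_iff[OF assms(1) pos])
  have O_iff: "A \<in> carrier ?O \<longleftrightarrow> A \<in> carrier_mat d d \<and> weighted_bounded (\<lambda>_. 1) d A \<and>
      (\<exists>B\<in>carrier_mat d d. weighted_bounded (\<lambda>_. 1) d B \<and> B * A = 1\<^sub>m d)" for A
    unfolding padic_orthogonal_group_def padic_dist_eq_deformed_dist
    by (rule deformed_isometry_iff[OF assms(1)]) simp
  have upper_iff: "weighted_bounded q d A \<longleftrightarrow>
      weighted_bounded (\<lambda>_. 1) d A \<and> (\<forall>a<d. \<forall>b<a. padic_abs (A $$ (a, b)) < 1)"
    for A :: "'p padic mat"
    by (rule weighted_bounded_iff_upper_triangular_mod_prime[OF assms(2,3)])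
  have carrier_eq: "carrier ?G =
      {A \<in> carrier ?O. \<forall>a<d. \<forall>b<a. \<exists>z\<in>padic_integers. A $$ (a, b) = of_nat CARD('p) * z}"
    unfolding padic_prime_multiple_iff
  proof (intro equalityI subsetI)
    fix A assume "A \<in> carrier ?G"
    thus "A \<in> {A \<in> carrier ?O. \<forall>a<d. \<forall>b<a. padic_abs (A $$ (a, b)) < 1}"
      unfolding mem_Collect_eq G_iff O_iff upper_iff by blast
  next
    fix A assume "A \<in> {A \<in> carrier ?O. \<forall>a<d. \<forall>b<a. padic_abs (A $$ (a, b)) < 1}"
    hence O: "A \<in> carrier ?O" and upper: "\<And>a b. a < d \<Longrightarrow> b < a \<Longrightarrow> padic_abs (A $$ (a, b)) < 1"
      by auto
    from O obtain B where A: "A \<in> carrier_mat d d" "weighted_bounded (\<lambda>_. 1) d A"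
      and B: "B \<in> carrier_mat d d" "weighted_bounded (\<lambda>_. 1) d B" and BA: "B * A = 1\<^sub>m d"
      unfolding O_iff by blast
    have "\<forall>a<d. \<forall>b<a. padic_abs (B $$ (a, b)) < 1"
      using inverse_upper_triangular_mod_prime[OF A B BA upper] by blast
    thus "A \<in> carrier ?G"
      unfolding G_iff upper_iff using A B BA upper by blast
  qed
  have "subgroup (carrier ?G) ?O"
  proof (rule group.group_incl_imp_subgroup)
    show "group ?O" by (rule group_padic_orthogonal_group[OF assms(1)])
    show "carrier ?G \<subseteq> carrier ?O" unfolding carrier_eq by blast
    have "?O\<lparr>carrier := carrier ?G\<rparr> = ?G"
      by (simp add: padic_orthogonal_group_def linear_isometry_group_def)
    thus "group (?O\<lparr>carrier := carrier ?G\<rparr>)"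
      using group_deformed_isometries[where q=q, OF assms(1) pos] by simp
  qed
  with carrier_eq show ?thesis by blast
qed

end
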